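(* If $X$ is a Tychonoff space, then $c(\mathscr U_X)=\pi(\mathscr U_X)=|X|$.
   Context: For a Tychonoff (completely regular Hausdorff) space $X$, $C(X)$ is the set of all continuous functions $X\to\mathbb R$. A nonempty family of sets $\alpha$ is directed if for any $A,B\in\alpha$ there is $E\in\alpha$ with $A\cup B\subseteq E$. $\mathscr D_X$ is the collection of all directed families $\alpha\subseteq\mathscr P(X)$. For $\alpha\in\mathscr D_X$, $C_\alpha(X)$ denotes the topology on $C(X)$ in which $U\subseteq C(X)$ is open iff for each $f\in U$ there are $A\in\alpha$ and a real $\varepsilon>0$ with $\{g\in C(X):\forall x\in A\ (|f(x)-g(x)|<\varepsilon)\}\subseteq U$. $\mathscr U_X:=\{C_\alpha(X):\alpha\in\mathscr D_X\}$, ordered by inclusion of topologies (written $\le$); it is a bounded distributive lattice whose least element is the indiscrete topology $C_\emptyset=C_{\{\emptyset\}}(X)$. Let $\mathscr U_X^+:=\mathscr U_X\setminus\{C_\emptyset\}$. A family $\mathscr S\subseteq\mathscr U_X^+$ is an antichain in $\mathscr U_X$ if for any distinct $\sigma,\tau\in\mathscr S$ the infimum $\sigma\wedge\tau$ in $\mathscr U_X$ equals $C_\emptyset$; it is dense in $\mathscr U_X$ if for each $\sigma\in\mathscr U_X^+$ there is $\tau\in\mathscr S$ with $\tau\le\sigma$. The cellularity $c(\mathscr U_X)$ is the supremum of the cardinalities of antichains in $\mathscr U_X$, and the density $\pi(\mathscr U_X)$ is the minimum cardinality of a dense subset of $\mathscr U_X$. *)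

theory Defs
  imports "HOL-Analysis.Analysis" "HOL-Algebra.Order"
begin

unbundle cardinal_syntax
no_notation Set_Algebras.elt_set_eq (infix "=o" 50)

definition tychonoff_space :: "'a topology \<Rightarrow> bool" where
  "tychonoff_space X \<longleftrightarrow> completely_regular_space X \<and> Hausdorff_space X"

text \<open>Functions on the carrier \<open>topspace X\<close> are made extensional, so that two of them are
  equal as soon as they agree on \<open>topspace X\<close>.\<close>

definition cont_funs :: "'a topology \<Rightarrow> ('a \<Rightarrow> real) set" where
  "cont_funs X = {f \<in> extensional (topspace X). continuous_map X euclideanreal f}"

definition directed_families :: "'a topology \<Rightarrow> 'a set set set" where
  "directed_families X =
     {\<alpha>. \<alpha> \<subseteq> Pow (topspace X) \<and> \<alpha> \<noteq> {} \<and> (\<forall>A\<in>\<alpha>. \<forall>B\<in>\<alpha>. \<exists>E\<in>\<alpha>. A \<union> B \<subseteq> E)}"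

definition C_open :: "'a topology \<Rightarrow> 'a set set \<Rightarrow> ('a \<Rightarrow> real) set \<Rightarrow> bool" where
  "C_open X \<alpha> U \<longleftrightarrow> U \<subseteq> cont_funs X \<and>
     (\<forall>f\<in>U. \<exists>A\<in>\<alpha>. \<exists>\<epsilon>>0. {g \<in> cont_funs X. \<forall>x\<in>A. \<bar>f x - g x\<bar> < \<epsilon>} \<subseteq> U)"

definition C_top :: "'a topology \<Rightarrow> 'a set set \<Rightarrow> ('a \<Rightarrow> real) topology" where
  "C_top X \<alpha> = topology (C_open X \<alpha>)"

lemma istopology_C_open:
  assumes "\<alpha> \<in> directed_families X"
  shows "istopology (C_open X \<alpha>)"
  unfolding istopology_def
proof (intro conjI allI impI)
  fix S T assume ST: "C_open X \<alpha> S" "C_open X \<alpha> T"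
  show "C_open X \<alpha> (S \<inter> T)"
    unfolding C_open_def
  proof (intro conjI ballI)
    show "S \<inter> T \<subseteq> cont_funs X" using ST by (auto simp: C_open_def)
    fix f assume f: "f \<in> S \<inter> T"
    obtain A d where A: "A \<in> \<alpha>" "d > 0" "{g \<in> cont_funs X. \<forall>x\<in>A. \<bar>f x - g x\<bar> < d} \<subseteq> S"
      using ST(1) f unfolding C_open_def by blast
    obtain B e where B: "B \<in> \<alpha>" "e > 0" "{g \<in> cont_funs X. \<forall>x\<in>B. \<bar>f x - g x\<bar> < e} \<subseteq> T"
      using ST(2) f unfolding C_open_def by blast
    obtain E where E: "E \<in> \<alpha>" "A \<union> B \<subseteq> E"
      using assms A(1) B(1) unfolding directed_families_def by blast
    have "{g \<in> cont_funs X. \<forall>x\<in>E. \<bar>f x - g x\<bar> < min d e} \<subseteq> S \<inter> T"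
    proof
      fix g assume g: "g \<in> {g \<in> cont_funs X. \<forall>x\<in>E. \<bar>f x - g x\<bar> < min d e}"
      then have "g \<in> {g \<in> cont_funs X. \<forall>x\<in>A. \<bar>f x - g x\<bar> < d}"
        and "g \<in> {g \<in> cont_funs X. \<forall>x\<in>B. \<bar>f x - g x\<bar> < e}"
        using E(2) by auto
      then show "g \<in> S \<inter> T" using A(3) B(3) by blast
    qed
    moreover have "min d e > 0" using A(2) B(2) by simp
    ultimately show "\<exists>A\<in>\<alpha>. \<exists>\<epsilon>>0. {g \<in> cont_funs X. \<forall>x\<in>A. \<bar>f x - g x\<bar> < \<epsilon>} \<subseteq> S \<inter> T"
      using E(1) by blast
  qed
next
  fix \<K> assume K: "\<forall>S\<in>\<K>. C_open X \<alpha> S"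
  show "C_open X \<alpha> (\<Union>\<K>)"
    unfolding C_open_def
  proof (intro conjI ballI)
    show "\<Union>\<K> \<subseteq> cont_funs X" using K by (auto simp: C_open_def)
    fix f assume "f \<in> \<Union>\<K>"
    then obtain S where S: "S \<in> \<K>" "f \<in> S" by blast
    then obtain A e where "A \<in> \<alpha>" "e > 0" "{g \<in> cont_funs X. \<forall>x\<in>A. \<bar>f x - g x\<bar> < e} \<subseteq> S"
      using K unfolding C_open_def by blast
    then show "\<exists>A\<in>\<alpha>. \<exists>\<epsilon>>0. {g \<in> cont_funs X. \<forall>x\<in>A. \<bar>f x - g x\<bar> < \<epsilon>} \<subseteq> \<Union>\<K>"
      using S(1) by (meson Union_upper subset_trans)
  qed
qed

lemma openin_C_top:
  assumes "\<alpha> \<in> directed_families X"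
  shows "openin (C_top X \<alpha>) U \<longleftrightarrow> C_open X \<alpha> U"
  using istopology_C_open[OF assms] by (simp add: C_top_def)

definition U_lattice :: "'a topology \<Rightarrow> ('a \<Rightarrow> real) topology gorder" where
  "U_lattice X =
     \<lparr>carrier = C_top X ` directed_families X,
      eq = (=),
      le = (\<lambda>\<sigma> \<tau>. \<forall>U. openin \<sigma> U \<longrightarrow> openin \<tau> U)\<rparr>"

definition C_empty :: "'a topology \<Rightarrow> ('a \<Rightarrow> real) topology" where
  "C_empty X = C_top X {{}}"

lemma openin_C_empty: "openin (C_empty X) U \<longleftrightarrow> U = {} \<or> U = cont_funs X"
proof -
  have "{{}} \<in> directed_families X" by (simp add: directed_families_def)
  then have "openin (C_empty X) U \<longleftrightarrow> C_open X {{}} U"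
    unfolding C_empty_def by (rule openin_C_top)
  also have "\<dots> \<longleftrightarrow> U = {} \<or> U = cont_funs X"
  proof -
    have "\<exists>\<epsilon>::real. \<epsilon> > 0" by (rule gt_ex)
    then show ?thesis by (simp add: C_open_def) blast
  qed
  finally show ?thesis .
qed

lemma C_empty_least: "least (U_lattice X) (C_empty X) (carrier (U_lattice X))"
proof -
  have "C_empty X \<in> carrier (U_lattice X)"
    by (auto simp: U_lattice_def C_empty_def directed_families_def)
  moreover have "le (U_lattice X) (C_empty X) \<tau>" if t: "\<tau> \<in> carrier (U_lattice X)" for \<tau>
  proof -
    obtain \<alpha> where a: "\<alpha> \<in> directed_families X" "\<tau> = C_top X \<alpha>"
      using t by (auto simp: U_lattice_def)
    then obtain A where "A \<in> \<alpha>" by (auto simp: directed_families_def)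
    then have "C_open X \<alpha> (cont_funs X)"
      unfolding C_open_def using zero_less_one[where 'a = real] by blast
    then show ?thesis
      using a by (auto simp: U_lattice_def openin_C_empty openin_C_top)
  qed
  ultimately show ?thesis by (simp add: least_def)
qed

definition U_plus :: "'a topology \<Rightarrow> ('a \<Rightarrow> real) topology set" where
  "U_plus X = carrier (U_lattice X) - {C_empty X}"

text \<open>\<open>greatest L i (Lower L {\<sigma>, \<tau>})\<close> says that the infimum of \<open>\<sigma>\<close> and \<open>\<tau>\<close> in \<open>L\<close> is \<open>i\<close>.\<close>

definition U_antichain :: "'a topology \<Rightarrow> ('a \<Rightarrow> real) topology set \<Rightarrow> bool" where
  "U_antichain X S \<longleftrightarrow> S \<subseteq> U_plus X \<and>
     (\<forall>\<sigma>\<in>S. \<forall>\<tau>\<in>S. \<sigma> \<noteq> \<tau> \<longrightarrow>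
        greatest (U_lattice X) (C_empty X) (Lower (U_lattice X) {\<sigma>, \<tau>}))"

definition U_dense :: "'a topology \<Rightarrow> ('a \<Rightarrow> real) topology set \<Rightarrow> bool" where
  "U_dense X S \<longleftrightarrow> S \<subseteq> U_plus X \<and> (\<forall>\<sigma>\<in>U_plus X. \<exists>\<tau>\<in>S. le (U_lattice X) \<tau> \<sigma>)"

lemma U_dense_U_plus: "U_dense X (U_plus X)"
  by (auto simp: U_dense_def U_lattice_def)

text \<open>Minimum and supremum of a set of cardinals, determined up to \<open>=o\<close>. The supremum is taken
  among cardinals on the same type; \<open>card_sup_least\<close> shows that it is nevertheless the least
  among the upper bounds on all types.\<close>

definition card_min :: "'k rel set \<Rightarrow> 'k rel" where
  "card_min R = (SOME r. r \<in> R \<and> (\<forall>r'\<in>R. r \<le>o r'))"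

definition card_sup :: "'k rel set \<Rightarrow> 'k rel" where
  "card_sup R = card_min {u. Card_order u \<and> (\<forall>r\<in>R. r \<le>o u)}"

lemma card_min:
  assumes "R \<noteq> {}" and "\<And>r. r \<in> R \<Longrightarrow> Card_order r"
  shows card_min_mem: "card_min R \<in> R"
    and card_min_le: "\<And>r. r \<in> R \<Longrightarrow> card_min R \<le>o r"
proof -
  have "\<exists>r. r \<in> R \<and> (\<forall>r'\<in>R. r \<le>o r')"
    using exists_minim_Card_order[of R] assms by blast
  from someI_ex[OF this] show "card_min R \<in> R" "\<And>r. r \<in> R \<Longrightarrow> card_min R \<le>o r"
    unfolding card_min_def by blast+
qed

lemma Card_order_le_UNIV:
  fixes r :: "'k rel"
  assumes "Card_order r"
  shows "r \<le>o |UNIV :: 'k set|"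
proof -
  have "|Field r| =o r" using assms by (rule card_of_Field_ordIso)
  then show ?thesis
    by (rule ordIso_ordLeq_trans[OF ordIso_symmetric card_of_mono1[OF subset_UNIV]])
qed

lemma card_sup_mem:
  fixes R :: "'k rel set"
  assumes "\<And>r. r \<in> R \<Longrightarrow> Card_order r"
  shows "card_sup R \<in> {u. Card_order u \<and> (\<forall>r\<in>R. r \<le>o u)}"
  unfolding card_sup_def
proof (rule card_min_mem)
  have "|UNIV :: 'k set| \<in> {u. Card_order u \<and> (\<forall>r\<in>R. r \<le>o u)}"
  proof (intro CollectI conjI ballI)
    show "Card_order |UNIV :: 'k set|" by (rule card_of_Card_order)
    show "r \<le>o |UNIV :: 'k set|" if "r \<in> R" for r
      using that by (intro Card_order_le_UNIV assms)
  qed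
  then show "{u :: 'k rel. Card_order u \<and> (\<forall>r\<in>R. r \<le>o u)} \<noteq> {}" by blast
qed simp

lemma card_sup_upper:
  assumes "\<And>r. r \<in> R \<Longrightarrow> Card_order r" and "r \<in> R"
  shows "r \<le>o card_sup R"
  using card_sup_mem[OF assms(1)] assms(2) by simp

lemma card_sup_least:
  fixes R :: "'k rel set" and u :: "'m rel"
  assumes R: "\<And>r. r \<in> R \<Longrightarrow> Card_order r"
    and u: "Card_order u" "\<And>r. r \<in> R \<Longrightarrow> r \<le>o u"
  shows "card_sup R \<le>o u"
proof (rule ccontr)
  assume nle: "\<not> card_sup R \<le>o u"
  have co: "Card_order (card_sup R)" using card_sup_mem[OF R] by simp
  have "Well_order u" "Well_order (card_sup R)"
    using u(1) co by (simp_all add: card_order_on_def)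
  then have "u \<le>o card_sup R" using nle ordLeq_total by (metis (no_types))
  then have "|Field u| \<le>o card_sup R"
    by (rule ordIso_ordLeq_trans[OF card_of_Field_ordIso[OF u(1)]])
  from iffD1[OF internalize_card_of_ordLeq this]
  obtain B :: "'k set" where "|Field u| =o |B|"
    by (elim exE conjE)
  then have uB: "u =o |B|"
    by (rule ordIso_transitive[OF ordIso_symmetric[OF card_of_Field_ordIso[OF u(1)]]])
  have "|B| \<in> {u. Card_order u \<and> (\<forall>r\<in>R. r \<le>o u)}"
  proof (intro CollectI conjI ballI)
    show "Card_order |B|" by (rule card_of_Card_order)
    show "r \<le>o |B|" if "r \<in> R" for r
      using that by (intro ordLeq_ordIso_trans[OF u(2) uB])
  qed
  then have "card_sup R \<le>o |B|"
    unfolding card_sup_def by (intro card_min_le) auto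
  then have "card_sup R \<le>o u"
    by (rule ordLeq_ordIso_trans[OF _ ordIso_symmetric[OF uB]])
  then show False using nle by (rule notE[rotated])
qed

definition U_cellularity :: "'a topology \<Rightarrow> ('a \<Rightarrow> real) topology rel" where
  "U_cellularity X = card_sup { |S| | S. U_antichain X S}"

definition U_density :: "'a topology \<Rightarrow> ('a \<Rightarrow> real) topology rel" where
  "U_density X = card_min { |S| | S. U_dense X S}"

end

theory Submission
  imports Defs
begin

text \<open>The point topologies \<open>C\<^sub>x = C_top X {{x}}\<close> form an antichain that lies below every element of
  \<open>U_plus X\<close>: a nonempty set open for both \<open>C\<^sub>x\<close> and \<open>C\<^sub>y\<close> with \<open>x \<noteq> y\<close> is everything, because
  it contains with \<open>f\<close> each \<open>h\<close> with \<open>h x = f x\<close>, hence each \<open>g\<close> with \<open>g y = h y\<close>, and the values of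
  \<open>h\<close> at \<open>x\<close> and \<open>y\<close> can be prescribed. So assigning to a member of an antichain a point topology
  below it, or to a point topology a member of a dense set below it, is injective.\<close>

definition C_point :: "'a topology \<Rightarrow> 'a \<Rightarrow> ('a \<Rightarrow> real) topology" where
  "C_point X x = C_top X {{x}}"

lemma singleton_directed_families:
  "x \<in> topspace X \<Longrightarrow> {{x}} \<in> directed_families X"
  by (simp add: directed_families_def)

lemma openin_C_point:
  assumes "x \<in> topspace X"
  shows "openin (C_point X x) U \<longleftrightarrow> U \<subseteq> cont_funs X \<and>
    (\<forall>f\<in>U. \<exists>\<epsilon>>0. {g \<in> cont_funs X. \<bar>f x - g x\<bar> < \<epsilon>} \<subseteq> U)"
  unfolding C_point_def openin_C_top[OF singleton_directed_families[OF assms]] C_open_def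
  by simp

text \<open>A basic neighbourhood in \<open>C_point X x\<close> tests only the value at
  \<open>x\<close>, and functions that agree there are at distance 0, below every positive
  \<epsilon>.\<close>

lemma openin_C_point_same_value:
  assumes "x \<in> topspace X" "openin (C_point X x) U" "f \<in> U" "g \<in> cont_funs X" "g x = f x"
  shows "g \<in> U"
proof -
  obtain \<epsilon> :: real where "\<epsilon> > 0" "{g \<in> cont_funs X. \<bar>f x - g x\<bar> < \<epsilon>} \<subseteq> U"
    using assms(2,3) unfolding openin_C_point[OF assms(1)] by blast
  with assms(4,5) show ?thesis by auto
qed

lemma restrict_const_cont_funs: "(\<lambda>_\<in>topspace X. c) \<in> cont_funs X"
  unfolding cont_funs_def
  by (auto intro: continuous_map_eq[where f = "\<lambda>_. c"])

lemma tychonoff_space_interpolate: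
  assumes "tychonoff_space X" "x \<in> topspace X" "y \<in> topspace X" "x \<noteq> y"
  obtains h where "h \<in> cont_funs X" "h x = a" "h y = b"
proof -
  have "closedin X {y}"
    using assms(1,3) unfolding tychonoff_space_def
    by (simp add: closedin_Hausdorff_singleton)
  moreover have "x \<in> topspace X - {y}" using assms(2,4) by simp
  ultimately obtain \<phi> where \<phi>: "continuous_map X (top_of_set {0..1::real}) \<phi>" "\<phi> x = 0" "\<phi> y = 1"
    using assms(1) unfolding tychonoff_space_def completely_regular_space_def by force
  \<comment> \<open>The affine map sending 0 to \<open>a\<close> and 1 to \<open>b\<close> rescales
    the separating function; restricting it to \<open>topspace X\<close> makes it extensional, as
    \<open>cont_funs\<close> demands.\<close>
  define h where "h = (\<lambda>z\<in>topspace X. a + (b - a) * \<phi> z)"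
  have "continuous_map X euclideanreal \<phi>"
    using \<phi>(1) continuous_map_in_subtopology by blast
  then have "continuous_map X euclideanreal (\<lambda>z. a + (b - a) * \<phi> z)"
    by (intro continuous_intros)
  then have "h \<in> cont_funs X"
    unfolding cont_funs_def h_def by (auto intro: continuous_map_eq)
  moreover have "h x = a" "h y = b" using assms(2,3) \<phi> by (simp_all add: h_def)
  ultimately show ?thesis by (rule that)
qed

text \<open>The preimage of an open ray under evaluation at \<open>x\<close> is open and contains
  the constant 0 but not the constant 1, so it is neither empty nor everything.\<close>

lemma C_point_not_le_C_empty:
  assumes x: "x \<in> topspace X"
  shows "\<not> le (U_lattice X) (C_point X x) (C_empty X)"
proof
  assume le: "le (U_lattice X) (C_point X x) (C_empty X)"
  define U where "U = {f \<in> cont_funs X. f x < 1}"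
  have "openin (C_point X x) U"
    unfolding openin_C_point[OF x]
  proof (intro conjI ballI)
    fix f assume f: "f \<in> U"
    show "\<exists>\<epsilon>>0. {g \<in> cont_funs X. \<bar>f x - g x\<bar> < \<epsilon>} \<subseteq> U"
      \<comment> \<open>The radius is the distance from \<open>f x\<close> to the end of the
        ray.\<close>
      by (rule exI[of _ "1 - f x"]) (use f in \<open>auto simp: U_def\<close>)
  qed (auto simp: U_def)
  then have "U = {} \<or> U = cont_funs X"
    using le by (simp add: U_lattice_def openin_C_empty)
  moreover have "(\<lambda>_\<in>topspace X. 0) \<in> U"
    using x by (simp add: U_def restrict_const_cont_funs)
  moreover have "(\<lambda>_\<in>topspace X. 1) \<in> cont_funs X - U"
    using x by (simp add: U_def restrict_const_cont_funs)
  ultimately show False by blast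
qed

lemma C_point_in_U_plus:
  assumes "x \<in> topspace X"
  shows "C_point X x \<in> U_plus X"
proof -
  have "C_point X x \<noteq> C_empty X"
    using C_point_not_le_C_empty[OF assms] by (auto simp: U_lattice_def)
  then show ?thesis
    using singleton_directed_families[OF assms]
    by (auto simp: U_plus_def U_lattice_def C_point_def)
qed

text \<open>A nontrivial topology comes from a family with a nonempty member \<open>A\<close>. Any
  point of \<open>A\<close> will do: closeness on all of \<open>A\<close> implies closeness at that
  point, so the same \<open>A\<close> and \<epsilon> serve.\<close>

lemma C_point_below_U_plus:
  assumes "\<sigma> \<in> U_plus X"
  obtains x where "x \<in> topspace X" "le (U_lattice X) (C_point X x) \<sigma>"
proof -
  obtain \<alpha> where \<alpha>: "\<alpha> \<in> directed_families X" "\<sigma> = C_top X \<alpha>" "\<sigma> \<noteq> C_empty X"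
    using assms by (auto simp: U_plus_def U_lattice_def)
  have "\<alpha> \<noteq> {{}}" using \<alpha>(2,3) by (auto simp: C_empty_def)
  moreover have "\<alpha> \<noteq> {}" using \<alpha>(1) by (simp add: directed_families_def)
  ultimately have "\<not> \<alpha> \<subseteq> {{}}" by (metis subset_singletonD)
  then obtain A x where A: "A \<in> \<alpha>" "x \<in> A" by blast
  then have x: "x \<in> topspace X" using \<alpha>(1) by (auto simp: directed_families_def)
  have "openin \<sigma> U" if U: "openin (C_point X x) U" for U
    unfolding \<alpha>(2) openin_C_top[OF \<alpha>(1)] C_open_def
  proof (intro conjI ballI)
    show "U \<subseteq> cont_funs X" using U by (simp add: openin_C_point[OF x])
    fix f assume "f \<in> U"
    then obtain \<epsilon> :: real where "\<epsilon> > 0" "{g \<in> cont_funs X. \<bar>f x - g x\<bar> < \<epsilon>} \<subseteq> U"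
      using U unfolding openin_C_point[OF x] by blast
    then show "\<exists>A\<in>\<alpha>. \<exists>\<epsilon>>0. {g \<in> cont_funs X. \<forall>x\<in>A. \<bar>f x - g x\<bar> < \<epsilon>} \<subseteq> U"
      using A by (intro bexI[of _ A] exI[of _ \<epsilon>] conjI) auto
  qed
  then have "le (U_lattice X) (C_point X x) \<sigma>" by (simp add: U_lattice_def)
  with x show ?thesis by (rule that)
qed

text \<open>Stated for any common lower bound \<tau>, so that it yields the infimum of two point
  topologies, the injectivity of \<open>C_point\<close> and the lower bound on dense sets
  alike.\<close>

lemma le_C_points_le_C_empty:
  assumes X: "tychonoff_space X" and xy: "x \<in> topspace X" "y \<in> topspace X" "x \<noteq> y"
    and le: "le (U_lattice X) \<tau> (C_point X x)" "le (U_lattice X) \<tau> (C_point X y)"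
  shows "le (U_lattice X) \<tau> (C_empty X)"
proof -
  have "U = {} \<or> U = cont_funs X" if "openin \<tau> U" for U
  proof (rule disjCI)
    assume "U \<noteq> cont_funs X"
    have Ux: "openin (C_point X x) U" and Uy: "openin (C_point X y) U"
      using le that by (simp_all add: U_lattice_def)
    show "U = {}"
    proof (rule ccontr)
      assume "U \<noteq> {}"
      then obtain f where f: "f \<in> U" by blast
      have "g \<in> U" if g: "g \<in> cont_funs X" for g
      proof -
        obtain h where h: "h \<in> cont_funs X" "h x = f x" "h y = g y"
          by (rule tychonoff_space_interpolate[OF X xy])
        have "h \<in> U" using openin_C_point_same_value[OF xy(1) Ux f] h by simp
        then show "g \<in> U" using openin_C_point_same_value[OF xy(2) Uy _ g] h by simp
      qed
      moreover have "U \<subseteq> cont_funs X" using Ux by (simp add: openin_C_point[OF xy(1)])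
      ultimately show False using \<open>U \<noteq> cont_funs X\<close> by blast
    qed
  qed
  then show ?thesis by (simp add: U_lattice_def openin_C_empty)
qed

lemma U_plus_not_le_C_empty:
  assumes "\<sigma> \<in> U_plus X"
  shows "\<not> le (U_lattice X) \<sigma> (C_empty X)"
proof -
  obtain x where x: "x \<in> topspace X" "le (U_lattice X) (C_point X x) \<sigma>"
    using C_point_below_U_plus[OF assms] .
  then show ?thesis
    using C_point_not_le_C_empty[OF x(1)] by (auto simp: U_lattice_def)
qed

text \<open>A point topology equal to another one is a common lower bound of both, hence would be
  trivial.\<close>

lemma inj_on_C_point:
  assumes "tychonoff_space X"
  shows "inj_on (C_point X) (topspace X)"
proof (rule inj_onI, rule ccontr)
  fix x y assume "x \<in> topspace X" "y \<in> topspace X" "C_point X x = C_point X y" "x \<noteq> y"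
  then show False
    using le_C_points_le_C_empty[OF assms, of x y "C_point X x"] C_point_not_le_C_empty[of x X]
    by (simp add: U_lattice_def)
qed

lemma U_antichain_C_point:
  assumes "tychonoff_space X"
  shows "U_antichain X (C_point X ` topspace X)"
  unfolding U_antichain_def
proof (intro conjI ballI impI)
  show "C_point X ` topspace X \<subseteq> U_plus X" by (auto intro: C_point_in_U_plus)
next
  fix \<sigma> \<tau> assume "\<sigma> \<in> C_point X ` topspace X" "\<tau> \<in> C_point X ` topspace X" "\<sigma> \<noteq> \<tau>"
  then obtain x y where xy: "x \<in> topspace X" "y \<in> topspace X" "x \<noteq> y"
    and eq: "\<sigma> = C_point X x" "\<tau> = C_point X y" by blast
  \<comment> \<open>\<open>Lower\<close> compares only with elements of the carrier, so membership
    of \<sigma> and \<tau> is needed to read off the two bounds on \<rho>.\<close>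
  have carrier: "\<sigma> \<in> carrier (U_lattice X)" "\<tau> \<in> carrier (U_lattice X)"
    using C_point_in_U_plus[OF xy(1)] C_point_in_U_plus[OF xy(2)] eq by (simp_all add: U_plus_def)
  show "greatest (U_lattice X) (C_empty X) (Lower (U_lattice X) {\<sigma>, \<tau>})"
    unfolding greatest_def
  proof (intro conjI ballI)
    show "Lower (U_lattice X) {\<sigma>, \<tau>} \<subseteq> carrier (U_lattice X)" by (rule Lower_closed)
    show "C_empty X \<in> Lower (U_lattice X) {\<sigma>, \<tau>}"
      using C_empty_least[of X] carrier by (auto simp: least_def Lower_def)
    fix \<rho> assume "\<rho> \<in> Lower (U_lattice X) {\<sigma>, \<tau>}"
    then have "le (U_lattice X) \<rho> \<sigma>" "le (U_lattice X) \<rho> \<tau>"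
      using carrier by (auto simp: Lower_def)
    then show "le (U_lattice X) \<rho> (C_empty X)"
      unfolding eq by (rule le_C_points_le_C_empty[OF assms xy])
  qed
qed

lemma U_dense_C_point: "U_dense X (C_point X ` topspace X)"
  unfolding U_dense_def
  by (auto intro: C_point_in_U_plus elim: C_point_below_U_plus)

lemma card_of_U_antichain_le:
  assumes S: "U_antichain X S"
  shows "|S| \<le>o |topspace X|"
proof -
  have S_plus: "S \<subseteq> U_plus X" using S by (simp add: U_antichain_def)
  have "\<forall>\<sigma>\<in>S. \<exists>x. x \<in> topspace X \<and> le (U_lattice X) (C_point X x) \<sigma>"
    using S_plus C_point_below_U_plus by blast
  then obtain p where p: "\<And>\<sigma>. \<sigma> \<in> S \<Longrightarrow> p \<sigma> \<in> topspace X"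
      "\<And>\<sigma>. \<sigma> \<in> S \<Longrightarrow> le (U_lattice X) (C_point X (p \<sigma>)) \<sigma>"
    by metis
  have "inj_on p S"
  proof (rule inj_onI, rule ccontr)
    fix \<sigma> \<tau> assume st: "\<sigma> \<in> S" "\<tau> \<in> S" "p \<sigma> = p \<tau>" "\<sigma> \<noteq> \<tau>"
    then have "greatest (U_lattice X) (C_empty X) (Lower (U_lattice X) {\<sigma>, \<tau>})"
      using S by (simp add: U_antichain_def)
    \<comment> \<open>A point shared by two members gives a common lower bound, which then lies
      below their infimum \<open>C_empty X\<close>.\<close>
    moreover have "C_point X (p \<sigma>) \<in> Lower (U_lattice X) {\<sigma>, \<tau>}"
      using p[OF st(1)] p(2)[OF st(2)] st(3) C_point_in_U_plus[of "p \<sigma>" X]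
      by (auto simp: Lower_def U_plus_def)
    ultimately have "le (U_lattice X) (C_point X (p \<sigma>)) (C_empty X)"
      by (simp add: greatest_def)
    then show False using C_point_not_le_C_empty[OF p(1)[OF st(1)]] by simp
  qed
  then show ?thesis
    using p(1) by (rule card_of_ordLeqI)
qed

lemma card_of_le_U_dense:
  assumes X: "tychonoff_space X" and S: "U_dense X S"
  shows "|topspace X| \<le>o |S|"
proof -
  have "\<exists>\<tau>\<in>S. le (U_lattice X) \<tau> (C_point X x)" if "x \<in> topspace X" for x
    using S C_point_in_U_plus[OF that] by (simp add: U_dense_def)
  then obtain t where t: "\<And>x. x \<in> topspace X \<Longrightarrow> t x \<in> S"
      "\<And>x. x \<in> topspace X \<Longrightarrow> le (U_lattice X) (t x) (C_point X x)"
    by metis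
  have "inj_on t (topspace X)"
  proof (rule inj_onI, rule ccontr)
    fix x y assume xy: "x \<in> topspace X" "y \<in> topspace X" "t x = t y" "x \<noteq> y"
    have "le (U_lattice X) (t x) (C_empty X)"
      \<comment> \<open>Rewriting \<open>t x\<close> to \<open>t y\<close> turns the remaining
        premise into the choice made at \<open>y\<close>: one member lies below two distinct point
        topologies.\<close>
      by (rule le_C_points_le_C_empty[OF X xy(1,2,4) t(2)[OF xy(1)]])
        (unfold xy(3), rule t(2)[OF xy(2)])
    moreover have "t x \<in> U_plus X" using S t(1)[OF xy(1)] by (auto simp: U_dense_def)
    ultimately show False using U_plus_not_le_C_empty[of "t x" X] by simp
  qed
  then show ?thesis
    using t(1) by (rule card_of_ordLeqI)
qed

lemma U_cellularity_eq_card_of: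
  assumes "tychonoff_space X"
  shows "U_cellularity X =o |topspace X|"
  unfolding ordIso_iff_ordLeq
proof
  show "U_cellularity X \<le>o |topspace X|"
    \<comment> \<open>The bound \<open>|topspace X|\<close> lives on another type than the
      antichains, which \<open>card_sup_least\<close> permits.\<close>
    unfolding U_cellularity_def by (rule card_sup_least) (auto intro: card_of_U_antichain_le card_of_Card_order)
  have "|C_point X ` topspace X| \<le>o U_cellularity X"
    unfolding U_cellularity_def
    by (rule card_sup_upper) (auto intro: U_antichain_C_point[OF assms] card_of_Card_order)
  moreover have "|topspace X| \<le>o |C_point X ` topspace X|"
    by (rule card_of_ordLeqI[OF inj_on_C_point[OF assms]]) (rule imageI)
  ultimately show "|topspace X| \<le>o U_cellularity X"
    by (rule ordLeq_transitive[rotated])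
qed

lemma U_density_eq_card_of:
  assumes "tychonoff_space X"
  shows "U_density X =o |topspace X|"
  unfolding ordIso_iff_ordLeq
proof
  have "U_density X \<le>o |C_point X ` topspace X|"
    unfolding U_density_def by (rule card_min_le) (auto intro: U_dense_C_point card_of_Card_order)
  then show "U_density X \<le>o |topspace X|"
    by (rule ordLeq_transitive[OF _ card_of_image])
  \<comment> \<open>The minimum is attained by some dense set, to which the bound for all dense sets
    applies.\<close>
  have "U_density X \<in> { |S| | S. U_dense X S}"
    unfolding U_density_def by (rule card_min_mem) (auto intro: U_dense_C_point card_of_Card_order)
  then show "|topspace X| \<le>o U_density X"
    using card_of_le_U_dense[OF assms] by auto
qed

theorem proposition4p2:
  fixes X :: "'a topology"
  assumes "tychonoff_space X"
  shows "U_cellularity X =o U_density X \<and> U_density X =o |topspace X|"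
  by (intro conjI U_density_eq_card_of[OF assms]
      ordIso_transitive[OF U_cellularity_eq_card_of[OF assms]]
      ordIso_symmetric[OF U_density_eq_card_of[OF assms]])

end
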